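(* Let $F\subset K^n$ and $H\subset K^m$ be $q$-varieties and let $\mathrm{Mor}(F,H)$ be the $\mathbb{F}_q$-vector space of morphisms from $F$ to $H$. Then there is a functorial isomorphism of $\mathbb{F}_q$-vector spaces $$\mathrm{Mor}(F,H)\simeq\mathrm{Hom}_{K\{\tau\}}\big(\Lambda_m/M(H),\ \Lambda_n/M(F)\big).$$
   Context: $p$ prime, $K$ algebraically closed of characteristic $p$, $q$ a power of $p$, $\mathbb{F}_q\subset K$. $K\{\tau\}$ is the ring (under composition) of $\mathbb{F}_q$-linear polynomials $\sum_{i=0}^d a_iX^{q^i}$, $a_i\in K$, with $\tau=X^q$. $\Lambda_n$ is the set of polynomials $\sum_{i=1}^nP_i(X_i)$ with $P_i\in K\{\tau\}$, a left $K\{\tau\}$-module via $P\cdot f=P\circ f$. A $q$-variety in $K^n$ is a set $Z(S)=\{x\in K^n: f(x)=0\ \forall f\in S\}$, $S\subset\Lambda_n$. $M(F)=\{f\in\Lambda_n: f(x)=0\ \forall x\in F\}$. A morphism $F\to H$ is a map $\psi:F\to H$ for which there exist $f_1,\dots,f_m\in\Lambda_n$ with $\psi(x)=(f_1(x),\dots,f_m(x))$ for all $x\in F$. *)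

theory Defs
  imports
    "Jordan_Normal_Form.VS_Connect"
    "HOL-Algebra.AbelCoset"
    "HOL-Library.Poly_Mapping"
begin

text \<open>
  The ground field \<open>K\<close> is the whole of a type \<open>'a\<close>, to be instantiated with class
  \<open>alg_closed_field\<close>. Vectors of \<open>K\<^sup>n\<close> are elements of \<open>carrier_vec n\<close>, so coordinates and
  variables are numbered from \<open>0\<close>. Records used only as modules leave \<open>mult\<close> and \<open>one\<close> unspecified,
  as in \<open>module_vec\<close>.
\<close>

text \<open>The copy of the field with \<open>q\<close> elements inside \<open>K\<close>, i.e. the roots of \<open>X\<^sup>q - X\<close>.\<close>

definition Fq :: "nat \<Rightarrow> 'a::field ring" where
  "Fq q = \<lparr>carrier = {c. c ^ q = c}, mult = (*), one = 1, zero = 0, add = (+)\<rparr>"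

text \<open>The ring \<open>K{\<tau>}\<close>; its multiplication is composition of polynomials.\<close>

definition twisted_polys :: "nat \<Rightarrow> 'a::field poly ring" where
  "twisted_polys q =
     \<lparr>carrier = {P. \<exists>d a. P = (\<Sum>i\<le>d. monom (a i) (q ^ i))},
      mult = pcompose, one = [:0, 1:], zero = 0, add = (+)\<rparr>"

type_synonym 'a mpoly = "(nat \<Rightarrow>\<^sub>0 nat) \<Rightarrow>\<^sub>0 'a"

definition Const :: "'a::zero \<Rightarrow> 'a mpoly" where
  "Const c = Poly_Mapping.single 0 c"

definition Var :: "nat \<Rightarrow> 'a::zero_neq_one mpoly" where
  "Var i = Poly_Mapping.single (Poly_Mapping.single i 1) 1"

definition mpoly_eval :: "'a::comm_semiring_1 mpoly \<Rightarrow> 'a vec \<Rightarrow> 'a" where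
  "mpoly_eval f x =
     (\<Sum>t\<in>Poly_Mapping.keys f. Poly_Mapping.lookup f t *
        (\<Prod>i\<in>Poly_Mapping.keys t. (x $ i) ^ Poly_Mapping.lookup t i))"

text \<open>The composite \<open>P \<circ> f\<close> for a univariate polynomial \<open>P\<close> and a multivariate polynomial \<open>f\<close>.\<close>

definition poly_comp :: "'a::comm_semiring_1 poly \<Rightarrow> 'a mpoly \<Rightarrow> 'a mpoly" where
  "poly_comp P f = poly (map_poly Const P) f"

definition Lambda :: "nat \<Rightarrow> nat \<Rightarrow> ('a::field poly, 'a mpoly) module" where
  "Lambda q n =
     \<lparr>carrier = {f. \<exists>P. (\<forall>i<n. P i \<in> carrier (twisted_polys q)) \<and> f = (\<Sum>i<n. poly_comp (P i) (Var i))},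
      mult = undefined, one = undefined, zero = 0, add = (+), smult = poly_comp\<rparr>"

definition zero_set :: "nat \<Rightarrow> 'a::field mpoly set \<Rightarrow> 'a vec set" where
  "zero_set n S = {x \<in> carrier_vec n. \<forall>f\<in>S. mpoly_eval f x = 0}"

definition q_variety :: "nat \<Rightarrow> nat \<Rightarrow> 'a::field vec set \<Rightarrow> bool" where
  "q_variety q n F \<longleftrightarrow> (\<exists>S \<subseteq> carrier (Lambda q n). F = zero_set n S)"

definition vanishing :: "nat \<Rightarrow> nat \<Rightarrow> 'a::field vec set \<Rightarrow> 'a mpoly set" where
  "vanishing q n F = {f \<in> carrier (Lambda q n). \<forall>x\<in>F. mpoly_eval f x = 0}"

text \<open>
  Quotient of a left module by a submodule \<open>N\<close>, with the additive cosets of \<open>N\<close> as elements. For a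
  submodule the union in \<open>smult\<close> is that of a single coset repeated.
\<close>

definition quot_module :: "('r, 'm) module \<Rightarrow> 'm set \<Rightarrow> ('r, 'm set) module" where
  "quot_module M N =
     \<lparr>carrier = a_rcosets\<^bsub>M\<^esub> N, mult = undefined, one = undefined,
      zero = N, add = set_add M,
      smult = (\<lambda>r U. \<Union>x\<in>U. N +>\<^bsub>M\<^esub> (r \<odot>\<^bsub>M\<^esub> x))\<rparr>"

definition coord_module :: "nat \<Rightarrow> nat \<Rightarrow> 'a::field vec set \<Rightarrow> ('a poly, 'a mpoly set) module" where
  "coord_module q n F = quot_module (Lambda q n) (vanishing q n F)"

text \<open>
  Maps are made extensional, so that equality of HOL functions is equality of maps on the given domain.
  \<open>Mor q n F m H\<close> is the space of morphisms from \<open>F \<subseteq> K\<^sup>n\<close> to \<open>H \<subseteq> K\<^sup>m\<close>, with pointwise operations.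
\<close>

definition Mor ::
  "nat \<Rightarrow> nat \<Rightarrow> 'a::field vec set \<Rightarrow> nat \<Rightarrow> 'a vec set \<Rightarrow> ('a, 'a vec \<Rightarrow> 'a vec) module" where
  "Mor q n F m H =
     \<lparr>carrier = {\<psi> \<in> F \<rightarrow>\<^sub>E H. \<exists>f. (\<forall>j<m. f j \<in> carrier (Lambda q n)) \<and>
                                 (\<forall>x\<in>F. \<psi> x = vec m (\<lambda>j. mpoly_eval (f j) x))},
      mult = undefined, one = undefined,
      zero = (\<lambda>x\<in>F. 0\<^sub>v m),
      add = (\<lambda>\<psi> \<phi>. \<lambda>x\<in>F. \<psi> x + \<phi> x),
      smult = (\<lambda>c \<psi>. \<lambda>x\<in>F. c \<cdot>\<^sub>v \<psi> x)\<rparr>"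

text \<open>
  The \<open>K{\<tau>}\<close>-linear maps \<open>M \<rightarrow> N\<close>. Here \<open>module_hom\<close> is used for left modules over a
  noncommutative ring; its definition only refers to the carriers and operations. A scalar
  \<open>c\<close> of \<open>Fq q\<close> acts on \<open>N\<close> as the element \<open>c X\<close> of \<open>K{\<tau>}\<close>, which is central because \<open>c\<^sup>q = c\<close>.
\<close>

definition Hom_space ::
  "nat \<Rightarrow> ('a::field poly, 'm) module \<Rightarrow> ('a poly, 'n) module \<Rightarrow> ('a, 'm \<Rightarrow> 'n) module" where
  "Hom_space q M N =
     \<lparr>carrier = LinearCombinations.module_hom (twisted_polys q) M N \<inter> extensional (carrier M),
      mult = undefined, one = undefined,
      zero = (\<lambda>u\<in>carrier M. \<zero>\<^bsub>N\<^esub>),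
      add = (\<lambda>\<phi> \<psi>. \<lambda>u\<in>carrier M. \<phi> u \<oplus>\<^bsub>N\<^esub> \<psi> u),
      smult = (\<lambda>c \<phi>. \<lambda>u\<in>carrier M. [:0, c:] \<odot>\<^bsub>N\<^esub> \<phi> u)\<rparr>"

text \<open>
  The action of a morphism \<open>\<psi>: F \<rightarrow> H\<close> on quotient modules, \<open>[g] \<mapsto> [g \<circ> \<psi>]\<close>: the class of
  \<open>g(f\<^sub>1, \<dots>, f\<^sub>m)\<close> modulo the polynomials vanishing on \<open>F\<close>, where \<open>\<psi> = (f\<^sub>1, \<dots>, f\<^sub>m)\<close> on \<open>F\<close>,
  consists of all elements of \<open>\<Lambda>\<^sub>n\<close> that agree with \<open>g \<circ> \<psi>\<close> on \<open>F\<close>.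
\<close>

definition pullback ::
  "nat \<Rightarrow> nat \<Rightarrow> 'a::field vec set \<Rightarrow> nat \<Rightarrow> 'a vec set \<Rightarrow> ('a vec \<Rightarrow> 'a vec)
     \<Rightarrow> 'a mpoly set \<Rightarrow> 'a mpoly set" where
  "pullback q n F m H \<psi> =
     (\<lambda>U\<in>carrier (coord_module q m H).
        {f \<in> carrier (Lambda q n). \<exists>g\<in>U. \<forall>x\<in>F. mpoly_eval f x = mpoly_eval g (\<psi> x)})"

end

theory Submission
  imports Defs
begin

text \<open>
  A morphism \<open>\<psi>\<close> acts on coordinate modules by \<open>[g] \<mapsto> [g \<circ> \<psi>]\<close>, which is functorial. It is recovered from
  this action because the class of the coordinate \<open>X\<^sub>j\<close> goes to the class of its \<open>j\<close>-th component.
  Conversely, given a \<open>K{\<tau>}\<close>-linear map, lift the images of the classes of the \<open>X\<^sub>j\<close> to \<open>f\<^sub>j \<in> \<Lambda>\<^sub>n\<close>; the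
  map \<open>(f\<^sub>1, \<dots>, f\<^sub>m)\<close> takes values in \<open>H\<close>, since every equation of \<open>H\<close> has zero class.
\<close>

section \<open>Polynomials in several variables\<close>

text \<open>Two elements of \<Lambda>_n are congruent modulo M(F) exactly when they take the same
  values on F. Identities between classes are therefore checked on values, and a pullback can be
  computed from any representative with the right values; the polynomials that describe a morphism
  on F are not unique, but only their values matter.

  The source of linearity is characteristic p: raising to the power \<open>q ^ i\<close> is additive
  on K and also on the ring of polynomials in several variables. This makes P \<circ> f additive in
  f, so that \<Lambda>_n is a left module, and it makes each element of \<Lambda>_n an F_q-linear
  function on K^n, so that q-varieties are F_q-subspaces and the pullback depends linearly on
  \<psi>.

  Since K{\<tau>} is not commutative, it does not act on the space of homomorphisms by scaling
  values. Scalars from F_q do, because c X is central when c^q = c.\<close>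

lemma mpoly_induct [case_names zero single add]:
  fixes f :: "'b \<Rightarrow>\<^sub>0 'c::comm_monoid_add"
  assumes "P 0" and "\<And>t c. P (Poly_Mapping.single t c)" and "\<And>f g. P f \<Longrightarrow> P g \<Longrightarrow> P (f + g)"
  shows "P f"
proof (induction f rule: Poly_Mapping.update_induct)
  case const
  show ?case by (rule assms)
next
  case (update f t c)
  have "Poly_Mapping.update t c f = f + Poly_Mapping.single t c"
    using update by (intro poly_mapping_eqI)
      (auto simp: lookup_update lookup_add lookup_single in_keys_iff when_def)
  then show ?case using update assms by simp
qed

lemma mpoly_eval_zero [simp]: "mpoly_eval 0 x = 0"
  by (simp add: mpoly_eval_def)

lemma mpoly_eval_add [simp]: "mpoly_eval (f + g) x = mpoly_eval f x + mpoly_eval g x"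
  unfolding mpoly_eval_def
  by (rule setsum_keys_plus_distrib) (auto simp: algebra_simps)

lemma mpoly_eval_single:
  "mpoly_eval (Poly_Mapping.single t c) x =
     c * (\<Prod>i\<in>Poly_Mapping.keys t. (x $ i) ^ Poly_Mapping.lookup t i)"
  by (simp add: mpoly_eval_def)

lemma monomial_eval_add:
  fixes s t :: "nat \<Rightarrow>\<^sub>0 nat" and x :: "'a::comm_semiring_1 vec"
  shows "(\<Prod>i\<in>Poly_Mapping.keys (s + t). (x $ i) ^ Poly_Mapping.lookup (s + t) i) =
     (\<Prod>i\<in>Poly_Mapping.keys s. (x $ i) ^ Poly_Mapping.lookup s i) *
     (\<Prod>i\<in>Poly_Mapping.keys t. (x $ i) ^ Poly_Mapping.lookup t i)"
proof -
  let ?A = "Poly_Mapping.keys s \<union> Poly_Mapping.keys t"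
  \<comment> \<open>Outside its support a monomial has exponent 0 and contributes a factor 1, so all
    three products can be taken over the union of the two supports.\<close>
  have extend: "(\<Prod>i\<in>Poly_Mapping.keys u. (x $ i) ^ Poly_Mapping.lookup u i) =
      (\<Prod>i\<in>?A. (x $ i) ^ Poly_Mapping.lookup u i)" if "Poly_Mapping.keys u \<subseteq> ?A" for u
    using that by (intro prod.mono_neutral_left) (auto simp: in_keys_iff)
  show ?thesis
    unfolding extend [OF keys_add] extend [OF Un_upper1] extend [OF Un_upper2]
    by (simp add: lookup_add power_add prod.distrib)
qed

text \<open>Both sides are additive in \<open>f\<close> and in \<open>g\<close>, which reduces the
  claim to two monomials, where exponents add.\<close>

lemma mpoly_eval_mult [simp]: "mpoly_eval (f * g) x = mpoly_eval f x * mpoly_eval g x"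
proof (induction f rule: mpoly_induct)
  case (single t c)
  show ?case
    by (induction g rule: mpoly_induct)
      (simp_all add: mult_single mpoly_eval_single monomial_eval_add algebra_simps)
qed (simp_all add: distrib_right)

lemma mpoly_eval_Const [simp]: "mpoly_eval (Const c) x = c"
  by (simp add: Const_def mpoly_eval_single)

lemma mpoly_eval_Var [simp]: "mpoly_eval (Var i) x = x $ i"
  by (simp add: Var_def mpoly_eval_single)

lemma mpoly_eval_sum: "mpoly_eval (sum f A) x = (\<Sum>i\<in>A. mpoly_eval (f i) x)"
  by (induction A rule: infinite_finite_induct) simp_all

lemma Const_0 [simp]: "Const 0 = 0"
  by (simp add: Const_def)

lemma Const_add: "Const (a + b) = Const a + Const b"
  by (simp add: Const_def single_add)

lemma Const_mult: "Const (a * b) = Const a * Const b"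
  by (simp add: Const_def mult_single)

lemma Const_eq_0_iff: "Const a = 0 \<longleftrightarrow> a = 0"
  by (metis Const_0 Const_def lookup_single_eq lookup_zero)

text \<open>Constants embed K injectively, so the same multiples of 1 vanish in both rings. This is
  what makes Frobenius powers additive on polynomials in several variables.\<close>

lemma CHAR_mpoly: "CHAR('a::comm_semiring_1 mpoly) = CHAR('a)"
proof (rule CHAR_eqI)
  have of_nat: "of_nat k = (Const (of_nat k) :: 'a mpoly)" for k
    by (simp add: Const_def)
  show "of_nat CHAR('a) = (0 :: 'a mpoly)"
    by (simp add: of_nat del: single_of_nat)
  show "CHAR('a) dvd k" if "of_nat k = (0 :: 'a mpoly)" for k
    using that by (simp add: of_nat Const_eq_0_iff of_nat_eq_0_iff_char_dvd)
qed

section \<open>Composition of a univariate polynomial with a multivariate one\<close>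

lemma poly_comp_0 [simp]: "poly_comp 0 f = 0"
  by (simp add: poly_comp_def)

lemma poly_comp_pCons [simp]: "poly_comp (pCons a P) f = Const a + f * poly_comp P f"
  by (cases "P = 0 \<and> a = 0") (auto simp: poly_comp_def map_poly_pCons)

lemma poly_comp_add: "poly_comp (P + Q) f = poly_comp P f + poly_comp Q f"
  by (induction P Q rule: poly_induct2) (simp_all add: Const_add algebra_simps)

lemma poly_comp_sum: "poly_comp (sum P A) f = (\<Sum>i\<in>A. poly_comp (P i) f)"
  by (induction A rule: infinite_finite_induct) (simp_all add: poly_comp_add)

lemma poly_comp_smult: "poly_comp (Polynomial.smult c P) f = Const c * poly_comp P f"
  by (induction P) (simp_all add: Const_mult algebra_simps)

lemma poly_comp_mult: "poly_comp (P * Q) f = poly_comp P f * poly_comp Q f"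
  by (induction P) (simp_all add: poly_comp_add poly_comp_smult algebra_simps)

text \<open>Multiplication in K{\<tau>} is composition, so this is the module axiom (PQ)f = P(Qf).
  It follows from the Horner form of \<open>pcompose\<close> because substituting \<open>f\<close>
  is a ring homomorphism.\<close>

lemma poly_comp_pcompose: "poly_comp (pcompose P Q) f = poly_comp P (poly_comp Q f)"
  by (induction P) (simp_all add: pcompose_pCons poly_comp_add poly_comp_mult)

lemma poly_comp_monom: "poly_comp (monom c k) f = Const c * f ^ k"
  by (induction k) (simp_all add: monom_0 monom_Suc algebra_simps)

lemma mpoly_eval_poly_comp [simp]: "mpoly_eval (poly_comp P f) x = poly P (mpoly_eval f x)"
  by (induction P) simp_all

section \<open>Twisted polynomials\<close>

lemma twisted_polys_iff:
  "P \<in> carrier (twisted_polys q) \<longleftrightarrow> (\<exists>d a. P = (\<Sum>i\<le>d. monom (a i) (q ^ i)))"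
  by (simp add: twisted_polys_def)

locale frobenius =
  fixes q e :: nat and K :: "'a::field itself"
  assumes prime_char: "prime CHAR('a)" and q: "q = CHAR('a) ^ e"
begin

lemma q_pow: "q ^ i = CHAR('a) ^ (e * i)"
  by (simp add: q power_mult)

lemma q_pos: "q > 0"
  using prime_char q by (simp add: prime_gt_0_nat)

lemma twisted_add:
  fixes P Q :: "'a poly"
  assumes "P \<in> carrier (twisted_polys q)" and "Q \<in> carrier (twisted_polys q)"
  shows "P + Q \<in> carrier (twisted_polys q)"
proof -
  obtain d a where P: "P = (\<Sum>i\<le>d. monom (a i) (q ^ i))"
    using assms(1) by (auto simp: twisted_polys_iff)
  obtain d' b where Q: "Q = (\<Sum>i\<le>d'. monom (b i) (q ^ i))"
    using assms(2) by (auto simp: twisted_polys_iff)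
  \<comment> \<open>The two sums may differ in length; both are padded with zero coefficients to the
    common length.\<close>
  have extend: "(\<Sum>i\<le>k. monom (c i) (q ^ i)) =
      (\<Sum>i\<le>max d d'. monom (if i \<le> k then c i else 0) (q ^ i))"
    if "k \<le> max d d'" for k and c :: "nat \<Rightarrow> 'a"
    using that by (intro sum.mono_neutral_cong_left) auto
  have "P + Q = (\<Sum>i\<le>max d d'.
      monom ((if i \<le> d then a i else 0) + (if i \<le> d' then b i else 0)) (q ^ i))"
    unfolding P Q extend [OF max.cobounded1] extend [OF max.cobounded2]
    by (simp add: sum.distrib add_monom [symmetric])
  then show ?thesis
    by (auto simp: twisted_polys_iff)
qed

lemma twisted_monom: "monom (c :: 'a) (q ^ k) \<in> carrier (twisted_polys q)"
proof -
  have "monom c (q ^ k) = (\<Sum>i\<le>k. monom (if i = k then c else 0) (q ^ i))"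
    by (simp add: if_distrib [where f = "\<lambda>c. monom c _"] cong: if_cong)
  then show ?thesis
    unfolding twisted_polys_iff by (intro exI [of _ k] exI [of _ "\<lambda>i. if i = k then c else 0"])
qed

lemma twisted_0: "(0 :: 'a poly) \<in> carrier (twisted_polys q)"
  using twisted_monom [of 0 0] by simp

lemma twisted_linear: "[:0, c :: 'a:] \<in> carrier (twisted_polys q)"
  using twisted_monom [of c 0] by (simp add: monom_Suc monom_0)

lemma twisted_sum:
  "(\<And>i. i \<in> A \<Longrightarrow> P i \<in> carrier (twisted_polys q)) \<Longrightarrow>
    (sum P A :: 'a poly) \<in> carrier (twisted_polys q)"
  by (induction A rule: infinite_finite_induct) (auto intro: twisted_add twisted_0)

text \<open>Taking the power \<open>q ^ i\<close> of a sum can be done termwise, so each term of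
  \<open>P\<close> turns \<open>Q\<close> into another twisted polynomial. This is the commutation
  rule \<tau> b = b^q \<tau> in terms of polynomials.\<close>

lemma twisted_pcompose:
  fixes P Q :: "'a poly"
  assumes "P \<in> carrier (twisted_polys q)" and "Q \<in> carrier (twisted_polys q)"
  shows "pcompose P Q \<in> carrier (twisted_polys q)"
proof -
  obtain d a where P: "P = (\<Sum>i\<le>d. monom (a i) (q ^ i))"
    using assms(1) by (auto simp: twisted_polys_iff)
  obtain d' b where Q: "Q = (\<Sum>i\<le>d'. monom (b i) (q ^ i))"
    using assms(2) by (auto simp: twisted_polys_iff)
  have pcompose_monom: "pcompose (monom c k) Q = Polynomial.smult c (Q ^ k)" for c k
    by (induction k) (simp_all add: monom_0 monom_Suc pcompose_pCons)
  have smult_sum: "Polynomial.smult c (sum f A) = (\<Sum>j\<in>A. Polynomial.smult c (f j))"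
    for c :: 'a and f :: "nat \<Rightarrow> 'a poly" and A
    by (induction A rule: infinite_finite_induct) (simp_all add: smult_add_right)
  have "Q ^ (q ^ i) = (\<Sum>j\<le>d'. monom (b j ^ (q ^ i)) (q ^ (i + j)))" for i
    unfolding Q using prime_char
    by (subst freshmans_dream_sum' [where n = "e * i"])
      (simp_all add: q_pow monom_power power_add [symmetric] algebra_simps)
  then show ?thesis
    by (auto simp: P pcompose_sum pcompose_monom smult_sum smult_monom
        intro!: twisted_sum twisted_monom)
qed

text \<open>Only powers of the form \<open>q ^ i\<close> occur in \<open>P\<close>, and these are
  additive on multivariate polynomials. It supplies the distributive law P(f + g) = Pf + Pg of the
  left module \<Lambda>_n.\<close>

lemma poly_comp_twisted_add:
  fixes f g :: "'a mpoly"
  assumes "P \<in> carrier (twisted_polys q)"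
  shows "poly_comp P (f + g) = poly_comp P f + poly_comp P g"
proof -
  obtain d a where P: "P = (\<Sum>i\<le>d. monom (a i) (q ^ i))"
    using assms by (auto simp: twisted_polys_iff)
  have "(f + g) ^ (q ^ i) = f ^ (q ^ i) + g ^ (q ^ i)" for i
    by (rule freshmans_dream' [where n = "e * i"]) (simp_all add: CHAR_mpoly prime_char q_pow)
  then show ?thesis
    by (simp add: P poly_comp_sum poly_comp_monom sum.distrib algebra_simps)
qed

lemma poly_comp_twisted_0:
  assumes "(P :: 'a poly) \<in> carrier (twisted_polys q)"
  shows "poly_comp P 0 = 0"
  using poly_comp_twisted_add [OF assms, of 0 0] by (metis add_0 add_cancel_right_right)

lemma poly_comp_twisted_sum:
  assumes "(P :: 'a poly) \<in> carrier (twisted_polys q)"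
  shows "poly_comp P (sum f A) = (\<Sum>i\<in>A. poly_comp P (f i))"
  by (induction A rule: infinite_finite_induct)
    (simp_all add: assms poly_comp_twisted_0 poly_comp_twisted_add)

text \<open>The preceding polynomial identity is applied to two constants and evaluated. The point
  \<open>0\<^sub>v 0\<close> is arbitrary, since a constant has the same value everywhere.\<close>

lemma poly_twisted_add:
  assumes "(P :: 'a poly) \<in> carrier (twisted_polys q)"
  shows "poly P (x + y) = poly P x + poly P y"
  using arg_cong [OF poly_comp_twisted_add [OF assms, of "Const x" "Const y"],
      of "\<lambda>f. mpoly_eval f (0\<^sub>v 0)"] by simp

lemma poly_twisted_scale:
  assumes "(P :: 'a poly) \<in> carrier (twisted_polys q)" and c: "c ^ q = c"
  shows "poly P (c * x) = c * poly P x"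
proof -
  obtain d a where P: "P = (\<Sum>i\<le>d. monom (a i) (q ^ i))"
    using assms by (auto simp: twisted_polys_iff)
  have "c ^ (q ^ i) = c" for i
    by (induction i) (simp_all add: power_mult c)
  then show ?thesis
    by (simp add: P poly_sum poly_monom power_mult_distrib sum_distrib_left algebra_simps)
qed

section \<open>The modules \<open>\<Lambda>\<close>\<close>

lemma Lambda_iff:
  "(f :: 'a mpoly) \<in> carrier (Lambda q n) \<longleftrightarrow>
    (\<exists>P. (\<forall>i<n. P i \<in> carrier (twisted_polys q)) \<and> f = (\<Sum>i<n. poly_comp (P i) (Var i)))"
  by (simp add: Lambda_def)

lemma Lambda_ops [simp]:
  "zero (Lambda q n :: ('a poly, 'a mpoly) module) = 0"
  "add (Lambda q n :: ('a poly, 'a mpoly) module) = (+)"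
  "smult (Lambda q n :: ('a poly, 'a mpoly) module) = poly_comp"
  by (simp_all add: Lambda_def)

lemma Lambda_add:
  assumes "(f :: 'a mpoly) \<in> carrier (Lambda q n)" and "g \<in> carrier (Lambda q n)"
  shows "f + g \<in> carrier (Lambda q n)"
proof -
  obtain P where P: "\<forall>i<n. P i \<in> carrier (twisted_polys q)" "f = (\<Sum>i<n. poly_comp (P i) (Var i))"
    using assms(1) by (auto simp: Lambda_iff)
  obtain Q where Q: "\<forall>i<n. Q i \<in> carrier (twisted_polys q)" "g = (\<Sum>i<n. poly_comp (Q i) (Var i))"
    using assms(2) by (auto simp: Lambda_iff)
  have "f + g = (\<Sum>i<n. poly_comp (P i + Q i) (Var i))"
    by (simp add: P(2) Q(2) poly_comp_add sum.distrib)
  then show ?thesis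
    unfolding Lambda_iff using P(1) Q(1)
    by (intro exI [of _ "\<lambda>i. P i + Q i"]) (simp add: twisted_add)
qed

lemma Lambda_0: "(0 :: 'a mpoly) \<in> carrier (Lambda q n)"
  unfolding Lambda_iff by (intro exI [of _ "\<lambda>_. 0"]) (simp add: twisted_0)

lemma Lambda_sum:
  "(\<And>i. i \<in> A \<Longrightarrow> f i \<in> carrier (Lambda q n)) \<Longrightarrow> (sum f A :: 'a mpoly) \<in> carrier (Lambda q n)"
  by (induction A rule: infinite_finite_induct) (auto intro: Lambda_add Lambda_0)

lemma Lambda_poly_comp:
  assumes "P \<in> carrier (twisted_polys q)" and "(f :: 'a mpoly) \<in> carrier (Lambda q n)"
  shows "poly_comp P f \<in> carrier (Lambda q n)"
proof -
  obtain Q where Q: "\<forall>i<n. Q i \<in> carrier (twisted_polys q)" "f = (\<Sum>i<n. poly_comp (Q i) (Var i))"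
    using assms(2) by (auto simp: Lambda_iff)
  have "poly_comp P f = (\<Sum>i<n. poly_comp (pcompose P (Q i)) (Var i))"
    by (simp add: Q(2) poly_comp_twisted_sum assms(1) poly_comp_pcompose)
  then show ?thesis
    unfolding Lambda_iff using Q(1)
    by (intro exI [of _ "\<lambda>i. pcompose P (Q i)"]) (simp add: twisted_pcompose assms(1))
qed

lemma Lambda_Var:
  assumes "i < n"
  shows "(Var i :: 'a mpoly) \<in> carrier (Lambda q n)"
proof -
  have "Var i = (\<Sum>j<n. poly_comp (if j = i then [:0, 1:] else 0) (Var j :: 'a mpoly))"
    using assms by (simp add: if_distrib [where f = "\<lambda>P. poly_comp P _"] Const_def cong: if_cong)
  then show ?thesis
    unfolding Lambda_iff using twisted_linear [of 1] twisted_0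
    by (intro exI [of _ "\<lambda>j. if j = i then [:0, 1:] else 0"]) simp
qed

section \<open>Evaluation, substitution and differences in \<Lambda>_n\<close>

lemma Lambda_eval_add:
  assumes "(f :: 'a mpoly) \<in> carrier (Lambda q n)"
    and "x \<in> carrier_vec n" and "y \<in> carrier_vec n"
  shows "mpoly_eval f (x + y) = mpoly_eval f x + mpoly_eval f y"
  using assms by (auto simp: Lambda_iff mpoly_eval_sum poly_twisted_add sum.distrib)

lemma Lambda_eval_scale:
  assumes "(f :: 'a mpoly) \<in> carrier (Lambda q n)" and "x \<in> carrier_vec n" and "c ^ q = c"
  shows "mpoly_eval f (c \<cdot>\<^sub>v x) = c * mpoly_eval f x"
  using assms by (auto simp: Lambda_iff mpoly_eval_sum poly_twisted_scale sum_distrib_left)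

text \<open>If g is the sum of the P_j(X_j), then g(f_1, ..., f_m) is the sum of the P_j \<circ>
  f_j, which lies in the left module \<Lambda>_n. Both the pullback of polynomials and the
  composition of morphisms rest on it.\<close>

lemma Lambda_substitute:
  assumes "(g :: 'a mpoly) \<in> carrier (Lambda q m)"
    and "\<And>j. j < m \<Longrightarrow> f j \<in> carrier (Lambda q n)"
  obtains h where "h \<in> carrier (Lambda q n)"
    and "\<And>x. mpoly_eval h x = mpoly_eval g (vec m (\<lambda>j. mpoly_eval (f j) x))"
proof -
  obtain P where P: "\<forall>i<m. P i \<in> carrier (twisted_polys q)" "g = (\<Sum>i<m. poly_comp (P i) (Var i))"
    using assms(1) by (auto simp: Lambda_iff)
  show thesis
  proof (rule that)
    show "(\<Sum>j<m. poly_comp (P j) (f j)) \<in> carrier (Lambda q n)"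
      using assms(2) P(1) by (intro Lambda_sum Lambda_poly_comp) auto
    show "mpoly_eval (\<Sum>j<m. poly_comp (P j) (f j)) x =
        mpoly_eval g (vec m (\<lambda>j. mpoly_eval (f j) x))" for x
      unfolding P(2) mpoly_eval_sum by (intro sum.cong) simp_all
  qed
qed

text \<open>Negation is the action of the twisted polynomial -X.\<close>

lemma Lambda_minus:
  assumes "(f :: 'a mpoly) \<in> carrier (Lambda q n)"
  shows "- f \<in> carrier (Lambda q n)"
proof -
  have "poly_comp [:0, - 1:] f + f = f * (Const (- 1) + Const 1)"
    by (simp add: distrib_left Const_def)
  also have "\<dots> = 0"
    by (simp add: Const_add [symmetric])
  finally have "- f = poly_comp [:0, - 1:] f"
    by (rule minus_unique [OF trans [OF add.commute]])
  then show ?thesis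
    using Lambda_poly_comp [OF twisted_linear assms] by metis
qed

lemma Lambda_diff:
  assumes "(f :: 'a mpoly) \<in> carrier (Lambda q n)" and "g \<in> carrier (Lambda q n)"
  shows "f - g \<in> carrier (Lambda q n)"
  using Lambda_add [OF assms(1) Lambda_minus [OF assms(2)]] by simp

lemma mpoly_eval_diff: "mpoly_eval (f - g) x = mpoly_eval f x - mpoly_eval (g :: 'a mpoly) x"
  using mpoly_eval_add [of "f - g" g x] by (simp add: eq_diff_eq)

section \<open>Coordinate modules\<close>

text \<open>For \<open>f\<close> in \<Lambda>_n this is the coset f + M(F), described through values
  on F so that membership and equality become statements about functions.\<close>

definition cls :: "nat \<Rightarrow> 'a vec set \<Rightarrow> 'a mpoly \<Rightarrow> 'a mpoly set" where
  "cls n F f = {g \<in> carrier (Lambda q n). \<forall>x\<in>F. mpoly_eval g x = mpoly_eval f x}"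

lemma cls_eq_iff:
  assumes "f \<in> carrier (Lambda q n)"
  shows "cls n F f = cls n F g \<longleftrightarrow> (\<forall>x\<in>F. mpoly_eval f x = mpoly_eval g x)"
  using assms by (auto simp: cls_def)

lemma vanishing_coset:
  assumes "f \<in> carrier (Lambda q n)"
  shows "vanishing q n F +>\<^bsub>Lambda q n\<^esub> f = cls n F f"
proof (intro equalityI subsetI)
  fix g assume "g \<in> vanishing q n F +>\<^bsub>Lambda q n\<^esub> f"
  then show "g \<in> cls n F f"
    using assms by (auto simp: a_r_coset_def' vanishing_def cls_def intro: Lambda_add)
next
  fix g assume "g \<in> cls n F f"
  then have "g - f \<in> vanishing q n F"
    using assms by (auto simp: cls_def vanishing_def mpoly_eval_diff intro: Lambda_diff)
  then show "g \<in> vanishing q n F +>\<^bsub>Lambda q n\<^esub> f"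
    by (force simp: a_r_coset_def')
qed

lemma coord_carrier: "carrier (coord_module q n F) = cls n F ` carrier (Lambda q n)"
  by (auto simp: coord_module_def quot_module_def A_RCOSETS_def' vanishing_coset)

lemma coord_cls: "f \<in> carrier (Lambda q n) \<Longrightarrow> cls n F f \<in> carrier (coord_module q n F)"
  by (simp add: coord_carrier)

lemma coord_zero: "\<zero>\<^bsub>coord_module q n F\<^esub> = cls n F 0"
  by (simp add: coord_module_def quot_module_def vanishing_def cls_def)

lemma coord_add:
  assumes "f \<in> carrier (Lambda q n)" and "g \<in> carrier (Lambda q n)"
  shows "cls n F f \<oplus>\<^bsub>coord_module q n F\<^esub> cls n F g = cls n F (f + g)"
proof -
  \<comment> \<open>The sum of two cosets is a set of sums; an element \<open>k\<close> of the
    target class splits as \<open>(k - g) + g\<close>.\<close>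
  have "\<exists>h\<in>cls n F f. k = h + g" if "k \<in> cls n F (f + g)" for k
    using that assms
    by (intro bexI [of _ "k - g"]) (auto simp: cls_def mpoly_eval_diff intro: Lambda_diff)
  moreover have "g \<in> cls n F g"
    using assms by (simp add: cls_def)
  ultimately have "cls n F (f + g) \<subseteq> cls n F f <+>\<^bsub>Lambda q n\<^esub> cls n F g"
    by (auto simp: set_add_def') blast
  moreover have "cls n F f <+>\<^bsub>Lambda q n\<^esub> cls n F g \<subseteq> cls n F (f + g)"
    by (auto simp: set_add_def' cls_def intro: Lambda_add)
  ultimately show ?thesis
    by (auto simp: coord_module_def quot_module_def)
qed

lemma coord_smult:
  assumes "P \<in> carrier (twisted_polys q)" and "f \<in> carrier (Lambda q n)"
  shows "P \<odot>\<^bsub>coord_module q n F\<^esub> cls n F f = cls n F (poly_comp P f)"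
proof -
  have "vanishing q n F +>\<^bsub>Lambda q n\<^esub> (poly_comp P g) = cls n F (poly_comp P f)"
    if "g \<in> cls n F f" for g
  proof -
    have "g \<in> carrier (Lambda q n)" "\<forall>x\<in>F. mpoly_eval g x = mpoly_eval f x"
      using that by (auto simp: cls_def)
    then show ?thesis
      by (simp add: vanishing_coset Lambda_poly_comp cls_eq_iff assms)
  qed
  \<comment> \<open>Every representative yields the same coset; the union defining the action equals
    that coset because its index set is nonempty.\<close>
  moreover have "f \<in> cls n F f"
    using assms by (simp add: cls_def)
  ultimately show ?thesis
    by (auto simp: coord_module_def quot_module_def)
qed

section \<open>Vector spaces over the finite field\<close>

lemma Fq_simps [simp]:
  "c \<in> carrier (Fq q) \<longleftrightarrow> c ^ q = c"
  "mult (Fq q :: 'a ring) = (*)" "one (Fq q :: 'a ring) = 1"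
  "zero (Fq q :: 'a ring) = 0" "add (Fq q :: 'a ring) = (+)"
  by (simp_all add: Fq_def)

lemma Fq_add: "(a + b :: 'a) ^ q = a ^ q + b ^ q"
  using prime_char q by (rule freshmans_dream')

text \<open>Additivity gives (-a)^q + a^q = 0^q = 0, which avoids a case distinction on the parity
  of \<open>q\<close>.\<close>

lemma Fq_minus: "(- a :: 'a) ^ q = - (a ^ q)"
  using Fq_add [of "- a" a] q_pos by (simp add: power_0_left eq_neg_iff_add_eq_0)

lemma field_Fq: "field (Fq q :: 'a ring)"
proof -
  interpret cring "Fq q :: 'a ring"
  proof (intro cringI abelian_groupI comm_monoidI)
    show "\<exists>y\<in>carrier (Fq q). y \<oplus>\<^bsub>Fq q\<^esub> x = \<zero>\<^bsub>Fq q\<^esub>" if "x \<in> carrier (Fq q)" for x :: 'a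
      using that by (intro bexI [of _ "- x"]) (simp_all add: Fq_minus)
  qed (use q_pos in \<open>simp_all add: Fq_add power_mult_distrib algebra_simps\<close>)
  show ?thesis
  proof (rule cring_fieldI2)
    show "\<exists>b\<in>carrier (Fq q). a \<otimes>\<^bsub>Fq q\<^esub> b = \<one>\<^bsub>Fq q\<^esub>"
      if "a \<in> carrier (Fq q)" "a \<noteq> \<zero>\<^bsub>Fq q\<^esub>" for a :: 'a
      using that by (intro bexI [of _ "inverse a"]) (simp_all add: power_inverse)
  qed simp
qed

text \<open>Negatives need no separate assumption: -1 lies in F_q, and (-1)x + x = 0x = 0 by
  distributivity.\<close>

lemma Fq_vectorspaceI:
  fixes V :: "('a, 'b) module"
  assumes add: "\<And>x y. x \<in> carrier V \<Longrightarrow> y \<in> carrier V \<Longrightarrow> x \<oplus>\<^bsub>V\<^esub> y \<in> carrier V"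
    and zero: "\<zero>\<^bsub>V\<^esub> \<in> carrier V"
    and assoc: "\<And>x y z. x \<in> carrier V \<Longrightarrow> y \<in> carrier V \<Longrightarrow> z \<in> carrier V \<Longrightarrow>
      (x \<oplus>\<^bsub>V\<^esub> y) \<oplus>\<^bsub>V\<^esub> z = x \<oplus>\<^bsub>V\<^esub> (y \<oplus>\<^bsub>V\<^esub> z)"
    and comm: "\<And>x y. x \<in> carrier V \<Longrightarrow> y \<in> carrier V \<Longrightarrow> x \<oplus>\<^bsub>V\<^esub> y = y \<oplus>\<^bsub>V\<^esub> x"
    and l_zero: "\<And>x. x \<in> carrier V \<Longrightarrow> \<zero>\<^bsub>V\<^esub> \<oplus>\<^bsub>V\<^esub> x = x"
    and smult: "\<And>c x. c ^ q = c \<Longrightarrow> x \<in> carrier V \<Longrightarrow> c \<odot>\<^bsub>V\<^esub> x \<in> carrier V"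
    and l_distr: "\<And>a b x. a ^ q = a \<Longrightarrow> b ^ q = b \<Longrightarrow> x \<in> carrier V \<Longrightarrow>
      (a + b) \<odot>\<^bsub>V\<^esub> x = a \<odot>\<^bsub>V\<^esub> x \<oplus>\<^bsub>V\<^esub> b \<odot>\<^bsub>V\<^esub> x"
    and r_distr: "\<And>a x y. a ^ q = a \<Longrightarrow> x \<in> carrier V \<Longrightarrow> y \<in> carrier V \<Longrightarrow>
      a \<odot>\<^bsub>V\<^esub> (x \<oplus>\<^bsub>V\<^esub> y) = a \<odot>\<^bsub>V\<^esub> x \<oplus>\<^bsub>V\<^esub> a \<odot>\<^bsub>V\<^esub> y"
    and smult_assoc: "\<And>a b x. a ^ q = a \<Longrightarrow> b ^ q = b \<Longrightarrow> x \<in> carrier V \<Longrightarrow>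
      (a * b) \<odot>\<^bsub>V\<^esub> x = a \<odot>\<^bsub>V\<^esub> (b \<odot>\<^bsub>V\<^esub> x)"
    and one: "\<And>x. x \<in> carrier V \<Longrightarrow> 1 \<odot>\<^bsub>V\<^esub> x = x"
    and zero_smult: "\<And>x. x \<in> carrier V \<Longrightarrow> 0 \<odot>\<^bsub>V\<^esub> x = \<zero>\<^bsub>V\<^esub>"
  shows "vectorspace (Fq q) V"
proof -
  have minus_one: "(- 1 :: 'a) ^ q = - 1"
    by (simp add: Fq_minus)
  have "abelian_group V"
  proof (rule abelian_groupI)
    fix x assume x: "x \<in> carrier V"
    have "(- 1) \<odot>\<^bsub>V\<^esub> x \<oplus>\<^bsub>V\<^esub> x = (- 1 + 1) \<odot>\<^bsub>V\<^esub> x"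
      using x by (subst l_distr) (simp_all add: minus_one one)
    then show "\<exists>y\<in>carrier V. y \<oplus>\<^bsub>V\<^esub> x = \<zero>\<^bsub>V\<^esub>"
      using x smult minus_one zero_smult by force
  qed (fact add zero assoc comm l_zero)+
  show ?thesis
  proof (intro vectorspace.intro Module.module.intro Module.module_axioms.intro)
    show "cring (Fq q :: 'a ring)"
      using field_Fq by (rule fieldE)
  qed (use \<open>abelian_group V\<close> field_Fq in
      \<open>simp_all add: smult l_distr r_distr smult_assoc one\<close>)
qed

section \<open>q-varieties as F_q-subspaces\<close>

lemma q_variety_carrier: "q_variety q n F \<Longrightarrow> F \<subseteq> carrier_vec n"
  by (auto simp: q_variety_def zero_set_def)

lemma q_variety_add:
  assumes "q_variety q n F" and "x \<in> F" and "y \<in> (F :: 'a vec set)"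
  shows "x + y \<in> F"
  using assms by (auto simp: q_variety_def zero_set_def Lambda_eval_add subset_iff)

lemma q_variety_scale:
  assumes "q_variety q n F" and "x \<in> F" and "(c :: 'a) ^ q = c"
  shows "c \<cdot>\<^sub>v x \<in> F"
  using assms by (auto simp: q_variety_def zero_set_def Lambda_eval_scale subset_iff)

lemma q_variety_zero:
  assumes "q_variety q n (F :: 'a vec set)"
  shows "0\<^sub>v n \<in> F"
proof -
  have "mpoly_eval f (0\<^sub>v n) = 0" if "f \<in> carrier (Lambda q n)" for f :: "'a mpoly"
    using Lambda_eval_add [OF that, of "0\<^sub>v n" "0\<^sub>v n"]
    by (simp only: left_zero_vec zero_carrier_vec add_cancel_right_right)
  then show ?thesis
    using assms by (auto simp: q_variety_def zero_set_def subset_iff)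
qed

section \<open>Morphisms\<close>

lemma Mor_iff:
  "\<psi> \<in> carrier (Mor q n F m H) \<longleftrightarrow> \<psi> \<in> F \<rightarrow>\<^sub>E H \<and>
    (\<exists>f. (\<forall>j<m. f j \<in> carrier (Lambda q n)) \<and> (\<forall>x\<in>F. \<psi> x = vec m (\<lambda>j. mpoly_eval (f j) x)))"
  by (simp add: Mor_def)

lemma MorI:
  assumes "\<psi> \<in> F \<rightarrow>\<^sub>E H" and "\<And>j. j < m \<Longrightarrow> f j \<in> carrier (Lambda q n)"
    and "\<And>x. x \<in> F \<Longrightarrow> \<psi> x = vec m (\<lambda>j. mpoly_eval (f j) x)"
  shows "\<psi> \<in> carrier (Mor q n F m H)"
  using assms unfolding Mor_iff by blast

lemma Mor_ops [simp]:
  "zero (Mor q n F m H) = (\<lambda>x\<in>F. 0\<^sub>v m)"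
  "add (Mor q n F m H) = (\<lambda>\<psi> \<phi>. \<lambda>x\<in>F. \<psi> x + \<phi> x)"
  "smult (Mor q n F m H) = (\<lambda>c \<psi>. \<lambda>x\<in>F. c \<cdot>\<^sub>v \<psi> x)"
  by (simp_all add: Mor_def)

lemma Mor_apply: "\<psi> \<in> carrier (Mor q n F m H) \<Longrightarrow> x \<in> F \<Longrightarrow> \<psi> x \<in> H"
  by (auto simp: Mor_iff)

lemma Mor_ext:
  assumes "\<psi> \<in> carrier (Mor q n F m H)" and "\<phi> \<in> extensional F"
    and "\<And>x. x \<in> F \<Longrightarrow> \<psi> x = \<phi> x"
  shows "\<psi> = \<phi>"
  using assms by (intro extensionalityI [of _ F]) (auto simp: Mor_iff PiE_iff)

lemma Mor_add:
  assumes "q_variety q m (H :: 'a vec set)"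
    and "\<psi> \<in> carrier (Mor q n F m H)" and "\<phi> \<in> carrier (Mor q n F m H)"
  shows "(\<lambda>x\<in>F. \<psi> x + \<phi> x) \<in> carrier (Mor q n F m H)"
proof -
  obtain f where f: "\<forall>j<m. f j \<in> carrier (Lambda q n)" "\<forall>x\<in>F. \<psi> x = vec m (\<lambda>j. mpoly_eval (f j) x)"
    using assms(2) by (auto simp: Mor_iff)
  obtain g where g: "\<forall>j<m. g j \<in> carrier (Lambda q n)" "\<forall>x\<in>F. \<phi> x = vec m (\<lambda>j. mpoly_eval (g j) x)"
    using assms(3) by (auto simp: Mor_iff)
  show ?thesis
  proof (rule MorI)
    show "(\<lambda>x\<in>F. \<psi> x + \<phi> x) \<in> F \<rightarrow>\<^sub>E H"
      using assms by (auto intro: q_variety_add Mor_apply)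
    show "f j + g j \<in> carrier (Lambda q n)" if "j < m" for j
      using that f g by (simp add: Lambda_add)
    show "(\<lambda>x\<in>F. \<psi> x + \<phi> x) x = vec m (\<lambda>j. mpoly_eval (f j + g j) x)" if "x \<in> F" for x
      using that f(2) g(2) by (auto intro!: eq_vecI)
  qed
qed

lemma Mor_smult:
  assumes "q_variety q m (H :: 'a vec set)"
    and "\<psi> \<in> carrier (Mor q n F m H)" and "c ^ q = c"
  shows "(\<lambda>x\<in>F. c \<cdot>\<^sub>v \<psi> x) \<in> carrier (Mor q n F m H)"
proof -
  obtain f where f: "\<forall>j<m. f j \<in> carrier (Lambda q n)" "\<forall>x\<in>F. \<psi> x = vec m (\<lambda>j. mpoly_eval (f j) x)"
    using assms(2) by (auto simp: Mor_iff)
  show ?thesis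
  proof (rule MorI)
    show "(\<lambda>x\<in>F. c \<cdot>\<^sub>v \<psi> x) \<in> F \<rightarrow>\<^sub>E H"
      using assms by (auto intro: q_variety_scale Mor_apply)
    \<comment> \<open>Scaling a component by \<open>c\<close> is the action of c X, so the scaled
      component stays in \<Lambda>_n.\<close>
    show "poly_comp [:0, c:] (f j) \<in> carrier (Lambda q n)" if "j < m" for j
      using that f by (simp add: Lambda_poly_comp twisted_linear del: poly_comp_pCons)
    show "(\<lambda>x\<in>F. c \<cdot>\<^sub>v \<psi> x) x = vec m (\<lambda>j. mpoly_eval (poly_comp [:0, c:] (f j)) x)"
      if "x \<in> F" for x
      using that f(2) by (auto intro!: eq_vecI)
  qed
qed

lemma Mor_zero:
  assumes "q_variety q m (H :: 'a vec set)"
  shows "(\<lambda>x\<in>F. 0\<^sub>v m) \<in> carrier (Mor q n F m H)"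
  by (rule MorI [where f = "\<lambda>_. 0"])
    (use q_variety_zero [OF assms] in \<open>auto simp: Lambda_0 intro!: eq_vecI\<close>)

lemma Mor_vectorspace:
  assumes "q_variety q m (H :: 'a vec set)"
  shows "vectorspace (Fq q) (Mor q n F m H)"
proof -
  have carr: "\<psi> x \<in> carrier_vec m" if "\<psi> \<in> carrier (Mor q n F m H)" "x \<in> F" for \<psi> x
    using Mor_apply [OF that] q_variety_carrier [OF assms] by auto
  show ?thesis
  proof (rule Fq_vectorspaceI, goal_cases)
    case (1 x y)
    then show ?case using Mor_add [OF assms] by simp
  next
    case 2
    then show ?case using Mor_zero [OF assms] by simp
  next
    case (3 x y z)
    note carr [OF 3(1)] carr [OF 3(2)] carr [OF 3(3)]
    then show ?case by (auto intro!: restrict_ext assoc_add_vec)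
  next
    case (4 x y)
    note carr [OF 4(1)] carr [OF 4(2)]
    then show ?case by (auto intro!: restrict_ext comm_add_vec)
  next
    case (5 x)
    show ?case
      using Mor_ext [OF 5, symmetric] carr [OF 5] by simp
  next
    case (6 c x)
    then show ?case using Mor_smult [OF assms] by simp
  next
    case (7 a b x)
    note carr [OF 7(3)]
    then show ?case by (auto intro!: restrict_ext add_smult_distrib_vec)
  next
    case (8 a x y)
    note carr [OF 8(2)] carr [OF 8(3)]
    then show ?case by (auto intro!: restrict_ext smult_add_distrib_vec)
  next
    case (9 a b x)
    then show ?case by (auto intro!: restrict_ext simp: smult_smult_assoc)
  next
    case (10 x)
    show ?case
      using Mor_ext [OF 10, symmetric] carr [OF 10] by simp
  next
    case (11 x)
    have "0 \<cdot>\<^sub>v x y = 0\<^sub>v m" if "y \<in> F" for y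
      using carr [OF 11 that] by (auto intro!: eq_vecI)
    then show ?case by (auto intro!: restrict_ext)
  qed
qed

lemma Mor_compose:
  assumes "\<phi> \<in> carrier (Mor q n F m G)" and "\<psi> \<in> carrier (Mor q m G l (H :: 'a vec set))"
  shows "compose F \<psi> \<phi> \<in> carrier (Mor q n F l H)"
proof -
  obtain f where f: "\<forall>j<m. f j \<in> carrier (Lambda q n)" "\<forall>x\<in>F. \<phi> x = vec m (\<lambda>j. mpoly_eval (f j) x)"
    using assms(1) by (auto simp: Mor_iff)
  obtain g where g: "\<forall>j<l. g j \<in> carrier (Lambda q m)" "\<forall>x\<in>G. \<psi> x = vec l (\<lambda>j. mpoly_eval (g j) x)"
    using assms(2) by (auto simp: Mor_iff)
  have "\<exists>h. h \<in> carrier (Lambda q n) \<and>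
      (\<forall>x. mpoly_eval h x = mpoly_eval (g j) (vec m (\<lambda>j. mpoly_eval (f j) x)))" if "j < l" for j
    using Lambda_substitute [of "g j" m f n] f g that by metis
  then obtain h where h: "\<And>j. j < l \<Longrightarrow> h j \<in> carrier (Lambda q n)"
    "\<And>j x. j < l \<Longrightarrow> mpoly_eval (h j) x = mpoly_eval (g j) (vec m (\<lambda>j. mpoly_eval (f j) x))"
    by metis
  show ?thesis
  proof (rule MorI [OF _ h(1)])
    show "compose F \<psi> \<phi> \<in> F \<rightarrow>\<^sub>E H"
      using assms by (auto simp: compose_def intro: Mor_apply)
    fix x assume x: "x \<in> F"
    \<comment> \<open>The polynomials \<open>g j\<close> describe \<psi> on G only, so it matters
      that \<phi> maps F into G.\<close>
    then have "\<psi> (\<phi> x) = vec l (\<lambda>j. mpoly_eval (g j) (\<phi> x))"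
      using Mor_apply [OF assms(1)] g(2) by blast
    then show "compose F \<psi> \<phi> x = vec l (\<lambda>j. mpoly_eval (h j) x)"
      using x f(2) by (auto simp: compose_def h(2) intro!: eq_vecI)
  qed
qed

section \<open>Homomorphisms of coordinate modules\<close>

abbreviation coord :: "nat \<Rightarrow> 'a vec set \<Rightarrow> ('a poly, 'a mpoly set) module" where
  "coord n F \<equiv> coord_module q n F"

lemma coord_cases:
  assumes "u \<in> carrier (coord n F)"
  obtains f where "f \<in> carrier (Lambda q n)" and "u = cls n F f"
  using assms by (auto simp: coord_carrier)

lemma coord_closed:
  assumes "u \<in> carrier (coord n F)"
  shows "v \<in> carrier (coord n F) \<Longrightarrow> u \<oplus>\<^bsub>coord n F\<^esub> v \<in> carrier (coord n F)"
    and "P \<in> carrier (twisted_polys q) \<Longrightarrow> P \<odot>\<^bsub>coord n F\<^esub> u \<in> carrier (coord n F)"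
  using assms
  by (auto elim!: coord_cases simp: coord_add coord_smult intro!: coord_cls Lambda_add Lambda_poly_comp)

lemma coord_zero_closed: "\<zero>\<^bsub>coord n F\<^esub> \<in> carrier (coord n F)"
  by (simp add: coord_zero coord_cls Lambda_0)

lemma coord_assoc:
  assumes "u \<in> carrier (coord n F)" and "v \<in> carrier (coord n F)"
    and "w \<in> carrier (coord n F)"
  shows "(u \<oplus>\<^bsub>coord n F\<^esub> v) \<oplus>\<^bsub>coord n F\<^esub> w =
    u \<oplus>\<^bsub>coord n F\<^esub> (v \<oplus>\<^bsub>coord n F\<^esub> w)"
  using assms by (auto elim!: coord_cases simp: coord_add Lambda_add add.assoc)

lemma coord_comm:
  assumes "u \<in> carrier (coord n F)" and "v \<in> carrier (coord n F)"
  shows "u \<oplus>\<^bsub>coord n F\<^esub> v = v \<oplus>\<^bsub>coord n F\<^esub> u"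
  using assms by (auto elim!: coord_cases simp: coord_add add.commute)

lemma coord_zero_add:
  assumes "u \<in> carrier (coord n F)"
  shows "\<zero>\<^bsub>coord n F\<^esub> \<oplus>\<^bsub>coord n F\<^esub> u = u"
  using assms by (auto elim!: coord_cases simp: coord_add coord_zero Lambda_0)

lemma coord_smult_add:
  assumes "P \<in> carrier (twisted_polys q)"
    and "u \<in> carrier (coord n F)" and "v \<in> carrier (coord n F)"
  shows "P \<odot>\<^bsub>coord n F\<^esub> (u \<oplus>\<^bsub>coord n F\<^esub> v) =
    P \<odot>\<^bsub>coord n F\<^esub> u \<oplus>\<^bsub>coord n F\<^esub> P \<odot>\<^bsub>coord n F\<^esub> v"
  using assms
  by (auto elim!: coord_cases
      simp: coord_add coord_smult Lambda_add Lambda_poly_comp poly_comp_twisted_add)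

lemma coord_smult_zero:
  assumes "P \<in> carrier (twisted_polys q)"
  shows "P \<odot>\<^bsub>coord n F\<^esub> \<zero>\<^bsub>coord n F\<^esub> = \<zero>\<^bsub>coord n F\<^esub>"
  using assms by (simp add: coord_zero coord_smult Lambda_0 poly_comp_twisted_0)

text \<open>All five parts are compared on values. The last one is the centrality of a X:
  \<open>P\<close> has only exponents \<open>q ^ i\<close>, and these fix \<open>a\<close> when a^q
  = a.\<close>

lemma coord_scalars:
  assumes "u \<in> carrier (coord n F)"
  shows "[:0, a + b:] \<odot>\<^bsub>coord n F\<^esub> u =
      [:0, a:] \<odot>\<^bsub>coord n F\<^esub> u \<oplus>\<^bsub>coord n F\<^esub> [:0, b:] \<odot>\<^bsub>coord n F\<^esub> u"
    and "[:0, a * b:] \<odot>\<^bsub>coord n F\<^esub> u =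
      [:0, a:] \<odot>\<^bsub>coord n F\<^esub> ([:0, b:] \<odot>\<^bsub>coord n F\<^esub> u)"
    and "[:0, 1:] \<odot>\<^bsub>coord n F\<^esub> u = u"
    and "[:0, 0:] \<odot>\<^bsub>coord n F\<^esub> u = \<zero>\<^bsub>coord n F\<^esub>"
    and "P \<in> carrier (twisted_polys q) \<Longrightarrow> a ^ q = a \<Longrightarrow>
      P \<odot>\<^bsub>coord n F\<^esub> ([:0, a:] \<odot>\<^bsub>coord n F\<^esub> u) =
      [:0, a:] \<odot>\<^bsub>coord n F\<^esub> (P \<odot>\<^bsub>coord n F\<^esub> u)"
proof -
  obtain f where f: "f \<in> carrier (Lambda q n)" and u: "u = cls n F f"
    using assms by (rule coord_cases)
  note closed = f Lambda_poly_comp twisted_linear Lambda_add Lambda_0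
  have smult: "[:0, c:] \<odot>\<^bsub>coord n F\<^esub> cls n F g = cls n F (poly_comp [:0, c:] g)"
    if "g \<in> carrier (Lambda q n)" for g c
    by (rule coord_smult [OF twisted_linear that])
  show "[:0, a + b:] \<odot>\<^bsub>coord n F\<^esub> u =
      [:0, a:] \<odot>\<^bsub>coord n F\<^esub> u \<oplus>\<^bsub>coord n F\<^esub> [:0, b:] \<odot>\<^bsub>coord n F\<^esub> u"
    by (simp add: u smult coord_add cls_eq_iff closed distrib_left del: poly_comp_pCons)
  show "[:0, a * b:] \<odot>\<^bsub>coord n F\<^esub> u =
      [:0, a:] \<odot>\<^bsub>coord n F\<^esub> ([:0, b:] \<odot>\<^bsub>coord n F\<^esub> u)"
    by (simp add: u smult cls_eq_iff closed mult_ac del: poly_comp_pCons)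
  show "[:0, 1:] \<odot>\<^bsub>coord n F\<^esub> u = u"
    by (simp add: u smult cls_eq_iff closed del: poly_comp_pCons)
  show "[:0, 0:] \<odot>\<^bsub>coord n F\<^esub> u = \<zero>\<^bsub>coord n F\<^esub>"
    using smult [OF f, of 0] by (simp add: u coord_zero)
  show "P \<odot>\<^bsub>coord n F\<^esub> ([:0, a:] \<odot>\<^bsub>coord n F\<^esub> u) =
      [:0, a:] \<odot>\<^bsub>coord n F\<^esub> (P \<odot>\<^bsub>coord n F\<^esub> u)"
    if P: "P \<in> carrier (twisted_polys q)" and a: "a ^ q = a"
  proof -
    have "poly P (a * mpoly_eval f x) = a * poly P (mpoly_eval f x)" for x
      using P a by (rule poly_twisted_scale)
    then show ?thesis
      by (simp add: u smult coord_smult [OF P] cls_eq_iff closed P mult_ac del: poly_comp_pCons)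
  qed
qed

section \<open>The F_q-vector space of K{\<tau>}-linear maps\<close>

abbreviation Hom_coord ::
  "nat \<Rightarrow> 'a vec set \<Rightarrow> nat \<Rightarrow> 'a vec set \<Rightarrow> ('a, 'a mpoly set \<Rightarrow> 'a mpoly set) module" where
  "Hom_coord m H n F \<equiv> Hom_space q (coord m H) (coord n F)"

lemma Hom_iff:
  "\<phi> \<in> carrier (Hom_coord m H n F) \<longleftrightarrow>
    \<phi> \<in> carrier (coord m H) \<rightarrow>\<^sub>E carrier (coord n F) \<and>
    (\<forall>u\<in>carrier (coord m H). \<forall>v\<in>carrier (coord m H).
      \<phi> (u \<oplus>\<^bsub>coord m H\<^esub> v) = \<phi> u \<oplus>\<^bsub>coord n F\<^esub> \<phi> v) \<and>
    (\<forall>P\<in>carrier (twisted_polys q). \<forall>u\<in>carrier (coord m H).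
      \<phi> (P \<odot>\<^bsub>coord m H\<^esub> u) = P \<odot>\<^bsub>coord n F\<^esub> \<phi> u)"
  unfolding Hom_space_def LinearCombinations.module_hom_def PiE_def by auto

lemma Hom_ops [simp]:
  "zero (Hom_coord m H n F) = (\<lambda>u\<in>carrier (coord m H). \<zero>\<^bsub>coord n F\<^esub>)"
  "add (Hom_coord m H n F) =
    (\<lambda>\<phi> \<psi>. \<lambda>u\<in>carrier (coord m H). \<phi> u \<oplus>\<^bsub>coord n F\<^esub> \<psi> u)"
  "smult (Hom_coord m H n F) =
    (\<lambda>c \<phi>. \<lambda>u\<in>carrier (coord m H). [:0, c:] \<odot>\<^bsub>coord n F\<^esub> \<phi> u)"
  by (simp_all add: Hom_space_def)

lemma Hom_apply:
  "\<phi> \<in> carrier (Hom_coord m H n F) \<Longrightarrow> u \<in> carrier (coord m H) \<Longrightarrow>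
    \<phi> u \<in> carrier (coord n F)"
  by (auto simp: Hom_iff)

lemma Hom_ext:
  assumes "\<phi> \<in> carrier (Hom_coord m H n F)" and "\<psi> \<in> extensional (carrier (coord m H))"
    and "\<And>u. u \<in> carrier (coord m H) \<Longrightarrow> \<phi> u = \<psi> u"
  shows "\<phi> = \<psi>"
  using assms by (intro extensionalityI [of _ "carrier (coord m H)"])
    (auto simp: Hom_iff PiE_iff)

lemma Hom_add:
  assumes "\<phi> \<in> carrier (Hom_coord m H n F)" and "\<psi> \<in> carrier (Hom_coord m H n F)"
  shows "(\<lambda>u\<in>carrier (coord m H). \<phi> u \<oplus>\<^bsub>coord n F\<^esub> \<psi> u) \<in>
    carrier (Hom_coord m H n F)"
proof -
  \<comment> \<open>Additivity of a pointwise sum of homomorphisms comes down to exchanging the two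
    middle summands.\<close>
  have interchange: "(a \<oplus>\<^bsub>coord n F\<^esub> b) \<oplus>\<^bsub>coord n F\<^esub> (c \<oplus>\<^bsub>coord n F\<^esub> d) =
      (a \<oplus>\<^bsub>coord n F\<^esub> c) \<oplus>\<^bsub>coord n F\<^esub> (b \<oplus>\<^bsub>coord n F\<^esub> d)"
    if abcd: "a \<in> carrier (coord n F)" "b \<in> carrier (coord n F)"
      "c \<in> carrier (coord n F)" "d \<in> carrier (coord n F)" for a b c d
    using abcd by (auto elim!: coord_cases simp: coord_add Lambda_add algebra_simps)
  have hom: "\<phi> (u \<oplus>\<^bsub>coord m H\<^esub> v) = \<phi> u \<oplus>\<^bsub>coord n F\<^esub> \<phi> v"
    "\<psi> (u \<oplus>\<^bsub>coord m H\<^esub> v) = \<psi> u \<oplus>\<^bsub>coord n F\<^esub> \<psi> v"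
    "P \<in> carrier (twisted_polys q) \<Longrightarrow> \<phi> (P \<odot>\<^bsub>coord m H\<^esub> u) = P \<odot>\<^bsub>coord n F\<^esub> \<phi> u"
    "P \<in> carrier (twisted_polys q) \<Longrightarrow> \<psi> (P \<odot>\<^bsub>coord m H\<^esub> u) = P \<odot>\<^bsub>coord n F\<^esub> \<psi> u"
    if "u \<in> carrier (coord m H)" "v \<in> carrier (coord m H)" for u v P
    using assms that by (auto simp: Hom_iff)
  note closed = Hom_apply [OF assms(1)] Hom_apply [OF assms(2)]
  show ?thesis
    unfolding Hom_iff
  proof (intro conjI ballI)
    fix u v assume "u \<in> carrier (coord m H)" and "v \<in> carrier (coord m H)"
    then show "(\<lambda>u\<in>carrier (coord m H). \<phi> u \<oplus>\<^bsub>coord n F\<^esub> \<psi> u) (u \<oplus>\<^bsub>coord m H\<^esub> v) =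
        (\<lambda>u\<in>carrier (coord m H). \<phi> u \<oplus>\<^bsub>coord n F\<^esub> \<psi> u) u \<oplus>\<^bsub>coord n F\<^esub>
        (\<lambda>u\<in>carrier (coord m H). \<phi> u \<oplus>\<^bsub>coord n F\<^esub> \<psi> u) v"
      by (simp only: restrict_apply' coord_closed hom) (rule interchange; rule closed)
  qed (auto simp: hom coord_closed coord_smult_add closed)
qed

text \<open>K{\<tau>}-linearity of the scaled map requires c P \<phi>(u) = P c \<phi>(u), which is
  where \<open>c\<close> has to come from F_q.\<close>

lemma Hom_smult:
  assumes "\<phi> \<in> carrier (Hom_coord m H n F)" and "c ^ q = c"
  shows "(\<lambda>u\<in>carrier (coord m H). [:0, c:] \<odot>\<^bsub>coord n F\<^esub> \<phi> u) \<in>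
    carrier (Hom_coord m H n F)"
proof -
  have hom: "\<phi> (u \<oplus>\<^bsub>coord m H\<^esub> v) = \<phi> u \<oplus>\<^bsub>coord n F\<^esub> \<phi> v"
    "P \<in> carrier (twisted_polys q) \<Longrightarrow> \<phi> (P \<odot>\<^bsub>coord m H\<^esub> u) = P \<odot>\<^bsub>coord n F\<^esub> \<phi> u"
    if "u \<in> carrier (coord m H)" "v \<in> carrier (coord m H)" for u v P
    using assms that by (auto simp: Hom_iff)
  show ?thesis
    unfolding Hom_iff
    by (auto simp: hom coord_closed coord_smult_add coord_scalars(5) twisted_linear Hom_apply [OF assms(1)] assms(2))
qed

lemma Hom_zero:
  "(\<lambda>u\<in>carrier (coord m H). \<zero>\<^bsub>coord n F\<^esub>) \<in> carrier (Hom_coord m H n F)"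
  unfolding Hom_iff
  by (auto simp: coord_closed coord_zero_closed coord_zero_add coord_smult_zero)

lemma Hom_vectorspace: "vectorspace (Fq q) (Hom_coord m H n F)"
proof (rule Fq_vectorspaceI, goal_cases)
  case (1 x y)
  then show ?case using Hom_add by simp
next
  case 2
  show ?case using Hom_zero by simp
next
  case (3 x y z)
  then show ?case
    by (simp add: coord_assoc Hom_apply [OF 3(1)] Hom_apply [OF 3(2)] Hom_apply [OF 3(3)] cong: restrict_cong)
next
  case (4 x y)
  then show ?case
    by (simp add: coord_comm Hom_apply [OF 4(1)] Hom_apply [OF 4(2)] cong: restrict_cong)
next
  case (5 x)
  show ?case
    using Hom_ext [OF 5, symmetric] Hom_apply [OF 5] by (simp add: coord_zero_add)
next
  case (6 c x)
  then show ?case using Hom_smult by simp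
next
  case (7 a b x)
  then show ?case
    by (simp add: coord_scalars(1) Hom_apply [OF 7(3)] cong: restrict_cong)
next
  case (8 a x y)
  then show ?case
    by (simp add: coord_smult_add Hom_apply [OF 8(2)] Hom_apply [OF 8(3)] twisted_linear cong: restrict_cong)
next
  case (9 a b x)
  then show ?case
    by (simp add: coord_scalars(2) Hom_apply [OF 9(3)] cong: restrict_cong)
next
  case (10 x)
  show ?case
    using Hom_ext [OF 10, symmetric] Hom_apply [OF 10] by (simp add: coord_scalars(3))
next
  case (11 x)
  have "[:0, 0:] \<odot>\<^bsub>coord n F\<^esub> x u = \<zero>\<^bsub>coord n F\<^esub>"
    if "u \<in> carrier (coord m H)" for u
    using Hom_apply [OF 11 that] by (rule coord_scalars(4))
  then show ?case
    by (auto intro!: restrict_ext)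
qed

section \<open>The pullback\<close>

text \<open>Substituting the components of \<psi> into \<open>g\<close> represents g \<circ> \<psi>
  by an element of \<Lambda>_n. Later arguments use only its values and no longer mention the
  components.\<close>

lemma Mor_pull:
  assumes "\<psi> \<in> carrier (Mor q n F m (H :: 'a vec set))" and "g \<in> carrier (Lambda q m)"
  obtains h where "h \<in> carrier (Lambda q n)" and "\<And>x. x \<in> F \<Longrightarrow> mpoly_eval h x = mpoly_eval g (\<psi> x)"
proof -
  obtain f where f: "\<forall>j<m. f j \<in> carrier (Lambda q n)" "\<forall>x\<in>F. \<psi> x = vec m (\<lambda>j. mpoly_eval (f j) x)"
    using assms(1) by (auto simp: Mor_iff)
  obtain h where "h \<in> carrier (Lambda q n)"
    "\<And>x. mpoly_eval h x = mpoly_eval g (vec m (\<lambda>j. mpoly_eval (f j) x))"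
    using Lambda_substitute [of g m f n] assms(2) f(1) by metis
  then show thesis
    using f(2) that by simp
qed

text \<open>Polynomials congruent modulo M(H) agree on H, and \<psi> takes values in H, so their
  composites with \<psi> agree on F. This is the well-definedness of the pullback.\<close>

lemma pullback_cls:
  assumes "\<psi> \<in> carrier (Mor q n F m (H :: 'a vec set))" and "g \<in> carrier (Lambda q m)"
    and "\<And>x. x \<in> F \<Longrightarrow> mpoly_eval h x = mpoly_eval g (\<psi> x)"
  shows "pullback q n F m H \<psi> (cls m H g) = cls n F h"
proof -
  have "mpoly_eval g' (\<psi> x) = mpoly_eval h x" if "g' \<in> cls m H g" "x \<in> F" for g' x
    using that assms(3) Mor_apply [OF assms(1)] by (auto simp: cls_def)
  moreover have "g \<in> cls m H g"
    using assms(2) by (simp add: cls_def)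
  ultimately have "{f \<in> carrier (Lambda q n). \<exists>g'\<in>cls m H g. \<forall>x\<in>F. mpoly_eval f x = mpoly_eval g' (\<psi> x)}
      = cls n F h"
    unfolding cls_def [of n] by (intro Collect_cong) (metis (no_types, lifting))
  then show ?thesis
    using assms(2) by (simp add: pullback_def coord_cls)
qed

lemma pullback_extensional: "pullback q n F m (H :: 'a vec set) \<psi> \<in> extensional (carrier (coord m H))"
  by (simp add: pullback_def)

lemma pullback_hom:
  assumes "\<psi> \<in> carrier (Mor q n F m (H :: 'a vec set))"
  shows "pullback q n F m H \<psi> \<in> carrier (Hom_coord m H n F)"
  unfolding Hom_iff PiE_iff
proof (intro conjI ballI)
  fix u assume "u \<in> carrier (coord m H)"
  then obtain g where g: "g \<in> carrier (Lambda q m)" and u: "u = cls m H g"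
    by (rule coord_cases)
  obtain h where h: "h \<in> carrier (Lambda q n)" "\<And>x. x \<in> F \<Longrightarrow> mpoly_eval h x = mpoly_eval g (\<psi> x)"
    using Mor_pull [OF assms g] by metis
  show "pullback q n F m H \<psi> u \<in> carrier (coord n F)"
    using h by (simp add: u pullback_cls [OF assms g h(2)] coord_cls)
  show "pullback q n F m H \<psi> (P \<odot>\<^bsub>coord m H\<^esub> u) =
      P \<odot>\<^bsub>coord n F\<^esub> pullback q n F m H \<psi> u" if P: "P \<in> carrier (twisted_polys q)" for P
  proof -
    have "pullback q n F m H \<psi> (cls m H (poly_comp P g)) = cls n F (poly_comp P h)"
      using h P g by (intro pullback_cls [OF assms]) (simp_all add: Lambda_poly_comp)
    then show ?thesis
      by (simp add: u pullback_cls [OF assms g h(2)] coord_smult P g h(1))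
  qed
  fix v assume "v \<in> carrier (coord m H)"
  then obtain g' where g': "g' \<in> carrier (Lambda q m)" and v: "v = cls m H g'"
    by (rule coord_cases)
  obtain h' where h': "h' \<in> carrier (Lambda q n)" "\<And>x. x \<in> F \<Longrightarrow> mpoly_eval h' x = mpoly_eval g' (\<psi> x)"
    using Mor_pull [OF assms g'] by metis
  have "pullback q n F m H \<psi> (cls m H (g + g')) = cls n F (h + h')"
    using h h' g g' by (intro pullback_cls [OF assms]) (simp_all add: Lambda_add)
  then show "pullback q n F m H \<psi> (u \<oplus>\<^bsub>coord m H\<^esub> v) =
      pullback q n F m H \<psi> u \<oplus>\<^bsub>coord n F\<^esub> pullback q n F m H \<psi> v"
    by (simp add: u v pullback_cls [OF assms g h(2)] pullback_cls [OF assms g' h'(2)]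
        coord_add g g' h(1) h'(1))
qed (rule pullback_extensional)

text \<open>Additivity in the morphism, unlike additivity in the class, uses that \<open>g\<close>
  itself is an additive function: g(\<psi> + \<phi>) = g(\<psi>) + g(\<phi>) on F.\<close>

lemma pullback_add:
  assumes H: "q_variety q m (H :: 'a vec set)"
    and \<psi>: "\<psi> \<in> carrier (Mor q n F m H)" and \<phi>: "\<phi> \<in> carrier (Mor q n F m H)"
  shows "pullback q n F m H (\<lambda>x\<in>F. \<psi> x + \<phi> x) =
    (\<lambda>u\<in>carrier (coord m H).
      pullback q n F m H \<psi> u \<oplus>\<^bsub>coord n F\<^esub> pullback q n F m H \<phi> u)"
proof (rule Hom_ext [OF pullback_hom [OF Mor_add [OF assms]] restrict_extensional])
  fix u assume u_in: "u \<in> carrier (coord m H)"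
  then obtain g where g: "g \<in> carrier (Lambda q m)" and u: "u = cls m H g"
    by (rule coord_cases)
  obtain h where h: "h \<in> carrier (Lambda q n)" "\<And>x. x \<in> F \<Longrightarrow> mpoly_eval h x = mpoly_eval g (\<psi> x)"
    using Mor_pull [OF \<psi> g] by metis
  obtain h' where h': "h' \<in> carrier (Lambda q n)" "\<And>x. x \<in> F \<Longrightarrow> mpoly_eval h' x = mpoly_eval g (\<phi> x)"
    using Mor_pull [OF \<phi> g] by metis
  have carr: "\<psi> x \<in> carrier_vec m" "\<phi> x \<in> carrier_vec m" if "x \<in> F" for x
    using Mor_apply [OF \<psi> that] Mor_apply [OF \<phi> that] q_variety_carrier [OF H] by auto
  have "pullback q n F m H (\<lambda>x\<in>F. \<psi> x + \<phi> x) (cls m H g) = cls n F (h + h')"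
    by (intro pullback_cls [OF Mor_add [OF assms] g])
      (simp add: h(2) h'(2) Lambda_eval_add [OF g] carr)
  then show "pullback q n F m H (\<lambda>x\<in>F. \<psi> x + \<phi> x) u =
    (\<lambda>u\<in>carrier (coord m H).
      pullback q n F m H \<psi> u \<oplus>\<^bsub>coord n F\<^esub> pullback q n F m H \<phi> u) u"
    using u_in by (simp add: u pullback_cls [OF \<psi> g h(2)] pullback_cls [OF \<phi> g h'(2)]
        coord_add h(1) h'(1))
qed

lemma pullback_smult:
  assumes H: "q_variety q m (H :: 'a vec set)" and \<psi>: "\<psi> \<in> carrier (Mor q n F m H)" and c: "c ^ q = c"
  shows "pullback q n F m H (\<lambda>x\<in>F. c \<cdot>\<^sub>v \<psi> x) =
    (\<lambda>u\<in>carrier (coord m H). [:0, c:] \<odot>\<^bsub>coord n F\<^esub> pullback q n F m H \<psi> u)"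
proof (rule Hom_ext [OF pullback_hom [OF Mor_smult [OF assms]] restrict_extensional])
  fix u assume u_in: "u \<in> carrier (coord m H)"
  then obtain g where g: "g \<in> carrier (Lambda q m)" and u: "u = cls m H g"
    by (rule coord_cases)
  obtain h where h: "h \<in> carrier (Lambda q n)" "\<And>x. x \<in> F \<Longrightarrow> mpoly_eval h x = mpoly_eval g (\<psi> x)"
    using Mor_pull [OF \<psi> g] by metis
  have carr: "\<psi> x \<in> carrier_vec m" if "x \<in> F" for x
    using Mor_apply [OF \<psi> that] q_variety_carrier [OF H] by auto
  have "pullback q n F m H (\<lambda>x\<in>F. c \<cdot>\<^sub>v \<psi> x) (cls m H g) = cls n F (poly_comp [:0, c:] h)"
    by (intro pullback_cls [OF Mor_smult [OF assms] g])
      (simp add: h(2) Lambda_eval_scale [OF g] carr c mult_ac)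
  then show "pullback q n F m H (\<lambda>x\<in>F. c \<cdot>\<^sub>v \<psi> x) u =
    (\<lambda>u\<in>carrier (coord m H). [:0, c:] \<odot>\<^bsub>coord n F\<^esub> pullback q n F m H \<psi> u) u"
    using u_in by (simp add: u pullback_cls [OF \<psi> g h(2)] coord_smult twisted_linear h(1)
        del: poly_comp_pCons)
qed

lemma pullback_linear:
  assumes "q_variety q m (H :: 'a vec set)"
  shows "linear_map (Fq q) (Mor q n F m H) (Hom_coord m H n F) (pullback q n F m H)"
proof -
  have "pullback q n F m H \<in> LinearCombinations.module_hom (Fq q) (Mor q n F m H) (Hom_coord m H n F)"
    unfolding LinearCombinations.module_hom_def
    by (auto simp: pullback_hom pullback_add [OF assms] pullback_smult [OF assms])
  then show ?thesis
    using Mor_vectorspace [OF assms] Hom_vectorspace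
    by (intro linear_map.intro mod_hom.intro mod_hom_axioms.intro vectorspace.axioms(1))
qed

section \<open>Bijectivity of the pullback\<close>

lemma pullback_inj:
  assumes H: "q_variety q m (H :: 'a vec set)"
  shows "inj_on (pullback q n F m H) (carrier (Mor q n F m H))"
proof (rule inj_onI)
  fix \<psi> \<phi>
  assume \<psi>: "\<psi> \<in> carrier (Mor q n F m H)" and \<phi>: "\<phi> \<in> carrier (Mor q n F m H)"
    and eq: "pullback q n F m H \<psi> = pullback q n F m H \<phi>"
  show "\<psi> = \<phi>"
  proof (rule Mor_ext [OF \<psi>])
    show "\<phi> \<in> extensional F"
      using \<phi> by (auto simp: Mor_iff PiE_iff)
    fix x assume x: "x \<in> F"
    have "\<psi> x \<in> carrier_vec m" "\<phi> x \<in> carrier_vec m"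
      using Mor_apply [OF \<psi> x] Mor_apply [OF \<phi> x] q_variety_carrier [OF H] by auto
    moreover have "\<psi> x $ j = \<phi> x $ j" if j: "j < m" for j
    proof -
      note V = Lambda_Var [OF j]
      obtain h where h: "h \<in> carrier (Lambda q n)" "\<And>x. x \<in> F \<Longrightarrow> mpoly_eval h x = mpoly_eval (Var j) (\<psi> x)"
        using Mor_pull [OF \<psi> V] by metis
      obtain h' where h': "h' \<in> carrier (Lambda q n)" "\<And>x. x \<in> F \<Longrightarrow> mpoly_eval h' x = mpoly_eval (Var j) (\<phi> x)"
        using Mor_pull [OF \<phi> V] by metis
      \<comment> \<open>Both sides are the image of the class of X_j. Equal classes give equal
        values on F, which is all that equality of morphisms asks for.\<close>
      have "cls n F h = cls n F h'"
        using pullback_cls [OF \<psi> V h(2)] pullback_cls [OF \<phi> V h'(2)] eq by simp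
      then show ?thesis
        using x h h' by (simp add: cls_eq_iff)
    qed
    ultimately show "\<psi> x = \<phi> x"
      by (auto intro!: eq_vecI)
  qed
qed

lemma pullback_surj:
  assumes H: "q_variety q m (H :: 'a vec set)" and \<phi>: "\<phi> \<in> carrier (Hom_coord m H n F)"
  shows "\<exists>\<psi>\<in>carrier (Mor q n F m H). pullback q n F m H \<psi> = \<phi>"
proof -
  have "\<exists>f. f \<in> carrier (Lambda q n) \<and> \<phi> (cls m H (Var j)) = cls n F f" if "j < m" for j
    using Hom_apply [OF \<phi> coord_cls [OF Lambda_Var [OF that]]] by (auto elim!: coord_cases)
  then obtain f where f: "\<And>j. j < m \<Longrightarrow> f j \<in> carrier (Lambda q n)"
    "\<And>j. j < m \<Longrightarrow> \<phi> (cls m H (Var j)) = cls n F (f j)"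
    by metis
  have \<phi>_add: "\<phi> (cls m H (g + g')) = \<phi> (cls m H g) \<oplus>\<^bsub>coord n F\<^esub> \<phi> (cls m H g')"
    if "g \<in> carrier (Lambda q m)" "g' \<in> carrier (Lambda q m)" for g g'
    using \<phi> coord_cls [OF that(1)] coord_cls [OF that(2)]
    by (simp add: Hom_iff coord_add [OF that, symmetric])
  have \<phi>_smult: "\<phi> (cls m H (poly_comp P g)) = P \<odot>\<^bsub>coord n F\<^esub> \<phi> (cls m H g)"
    if "P \<in> carrier (twisted_polys q)" "g \<in> carrier (Lambda q m)" for P g
    using \<phi> coord_cls [OF that(2)] that(1) by (simp add: Hom_iff coord_smult [OF that, symmetric])
  \<comment> \<open>The zero class is the zero of K{\<tau>} acting on itself, so linearity over
    K{\<tau>} sends it to the zero class.\<close>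
  have \<phi>_zero: "\<phi> (cls m H 0) = cls n F 0"
  proof -
    have "\<phi> (cls m H (poly_comp 0 0)) = [:0, 0:] \<odot>\<^bsub>coord n F\<^esub> \<phi> (cls m H 0)"
      by (subst \<phi>_smult) (simp_all add: twisted_0 Lambda_0)
    then show ?thesis
      using coord_scalars(4) [OF Hom_apply [OF \<phi> coord_cls [OF Lambda_0]]] by (simp add: coord_zero)
  qed
  \<comment> \<open>The X_j generate \<Lambda>_m over K{\<tau>}, so their images determine \<phi>.
    The bound \<open>k \<le> m\<close> keeps every variable of the partial sum inside
    \<Lambda>_m.\<close>
  have \<phi>_sum: "\<phi> (cls m H (\<Sum>j<k. poly_comp (P j) (Var j))) = cls n F (\<Sum>j<k. poly_comp (P j) (f j))"
    if "k \<le> m" "\<forall>j<m. P j \<in> carrier (twisted_polys q)" for k P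
    using that(1)
  proof (induction k)
    case 0
    show ?case using \<phi>_zero by simp
  next
    case (Suc k)
    then have k: "k < m" and P: "\<And>j. j < Suc k \<Longrightarrow> P j \<in> carrier (twisted_polys q)"
      using that(2) by auto
    have "(\<Sum>j<k. poly_comp (P j) (Var j)) \<in> carrier (Lambda q m)"
      using P k by (intro Lambda_sum Lambda_poly_comp Lambda_Var) auto
    moreover have "(\<Sum>j<k. poly_comp (P j) (f j)) \<in> carrier (Lambda q n)"
      using P k by (intro Lambda_sum Lambda_poly_comp f) auto
    ultimately show ?case
      using Suc k by (simp add: \<phi>_add \<phi>_smult Lambda_poly_comp Lambda_Var P f coord_smult coord_add)
  qed
  define \<psi> where "\<psi> = (\<lambda>x\<in>F. vec m (\<lambda>j. mpoly_eval (f j) x))"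
  \<comment> \<open>In other words \<phi>[g] = [g \<circ> \<psi>], shown before \<psi> is known to
    map into H. It serves both to prove that and to identify \<phi> with the pullback.\<close>
  have \<phi>_cls: "\<exists>h\<in>carrier (Lambda q n). \<phi> (cls m H g) = cls n F h \<and>
      (\<forall>x\<in>F. mpoly_eval h x = mpoly_eval g (\<psi> x))" if g: "g \<in> carrier (Lambda q m)" for g
  proof -
    obtain P where P: "\<forall>j<m. P j \<in> carrier (twisted_polys q)" "g = (\<Sum>j<m. poly_comp (P j) (Var j))"
      using g by (auto simp: Lambda_iff)
    show ?thesis
    proof (intro bexI conjI ballI)
      show "\<phi> (cls m H g) = cls n F (\<Sum>j<m. poly_comp (P j) (f j))"
        unfolding P(2) by (rule \<phi>_sum [OF order_refl P(1)])
      show "(\<Sum>j<m. poly_comp (P j) (f j)) \<in> carrier (Lambda q n)"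
        using P(1) by (intro Lambda_sum Lambda_poly_comp f) auto
      show "mpoly_eval (\<Sum>j<m. poly_comp (P j) (f j)) x = mpoly_eval g (\<psi> x)" if "x \<in> F" for x
        unfolding P(2) mpoly_eval_sum using that by (intro sum.cong) (simp_all add: \<psi>_def)
    qed
  qed
  obtain S where S: "S \<subseteq> carrier (Lambda q m)" "H = zero_set m S"
    using H by (auto simp: q_variety_def)
  have "\<psi> x \<in> H" if x: "x \<in> F" for x
  proof -
    have "mpoly_eval g (\<psi> x) = 0" if g: "g \<in> S" for g
    proof -
      have g': "g \<in> carrier (Lambda q m)"
        using g S by auto
      obtain h where h: "h \<in> carrier (Lambda q n)" "\<phi> (cls m H g) = cls n F h"
        "\<forall>x\<in>F. mpoly_eval h x = mpoly_eval g (\<psi> x)"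
        using \<phi>_cls [OF g'] by auto
      \<comment> \<open>A defining equation of H vanishes on H, so its class is zero, and so is the
        class of g \<circ> \<psi> on F.\<close>
      have "cls m H g = cls m H 0"
        using g by (simp add: cls_eq_iff g' S(2) zero_set_def)
      then have "cls n F h = cls n F 0"
        using \<phi>_zero h(2) by simp
      then show ?thesis
        using h(1,3) x by (simp add: cls_eq_iff)
    qed
    then show ?thesis
      using x by (simp add: S(2) zero_set_def) (simp add: \<psi>_def)
  qed
  then have \<psi>: "\<psi> \<in> carrier (Mor q n F m H)"
    by (intro MorI [where f = f]) (auto simp: \<psi>_def f(1))
  have "pullback q n F m H \<psi> = \<phi>"
  proof (rule Hom_ext [OF pullback_hom [OF \<psi>]])
    show "\<phi> \<in> extensional (carrier (coord m H))"
      using \<phi> by (auto simp: Hom_iff PiE_iff)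
    fix u assume "u \<in> carrier (coord m H)"
    then obtain g where g: "g \<in> carrier (Lambda q m)" and u: "u = cls m H g"
      by (rule coord_cases)
    obtain h where h: "h \<in> carrier (Lambda q n)" "\<phi> (cls m H g) = cls n F h"
      "\<forall>x\<in>F. mpoly_eval h x = mpoly_eval g (\<psi> x)"
      using \<phi>_cls [OF g] by auto
    show "pullback q n F m H \<psi> u = \<phi> u"
      using pullback_cls [OF \<psi> g, of h] h by (simp add: u)
  qed
  with \<psi> show ?thesis by blast
qed

lemma pullback_bij:
  assumes "q_variety q m (H :: 'a vec set)"
  shows "bij_betw (pullback q n F m H) (carrier (Mor q n F m H)) (carrier (Hom_coord m H n F))"
  unfolding bij_betw_def
  using pullback_inj [OF assms] pullback_hom pullback_surj [OF assms] by blast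

section \<open>Functoriality and naturality\<close>

lemma pullback_id:
  "pullback q n F n (F :: 'a vec set) (\<lambda>x\<in>F. x) = (\<lambda>u\<in>carrier (coord n F). u)"
proof (rule extensionalityI [OF pullback_extensional restrict_extensional])
  fix u assume "u \<in> carrier (coord n F)"
  then show "pullback q n F n (F :: 'a vec set) (\<lambda>x\<in>F. x) u = (\<lambda>u\<in>carrier (coord n F). u) u"
    by (auto simp: coord_carrier pullback_def cls_def)
qed

text \<open>If \<open>h\<close> represents g \<circ> \<psi> on G and \<open>k\<close> represents h
  \<circ> \<phi> on F, then \<open>k\<close> represents g \<circ> \<psi> \<circ> \<phi>; the order
  of composition is reversed.\<close>

lemma pullback_compose:
  assumes \<phi>: "\<phi> \<in> carrier (Mor q n F m G)" and \<psi>: "\<psi> \<in> carrier (Mor q m G l (H :: 'a vec set))"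
  shows "pullback q n F l H (compose F \<psi> \<phi>) =
    compose (carrier (coord l H)) (pullback q n F m G \<phi>) (pullback q m G l H \<psi>)"
proof (rule extensionalityI [OF pullback_extensional compose_extensional])
  fix u assume u_in: "u \<in> carrier (coord l H)"
  then obtain g where g: "g \<in> carrier (Lambda q l)" and u: "u = cls l H g"
    by (rule coord_cases)
  obtain h where h: "h \<in> carrier (Lambda q m)" "\<And>x. x \<in> G \<Longrightarrow> mpoly_eval h x = mpoly_eval g (\<psi> x)"
    using Mor_pull [OF \<psi> g] by metis
  obtain k where k: "k \<in> carrier (Lambda q n)" "\<And>x. x \<in> F \<Longrightarrow> mpoly_eval k x = mpoly_eval h (\<phi> x)"
    using Mor_pull [OF \<phi> h(1)] by metis
  have "pullback q n F l H (compose F \<psi> \<phi>) (cls l H g) = cls n F k"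
    by (rule pullback_cls [OF Mor_compose [OF \<phi> \<psi>] g])
      (simp add: k(2) compose_def h(2) Mor_apply [OF \<phi>])
  then show "pullback q n F l H (compose F \<psi> \<phi>) u =
      compose (carrier (coord l H)) (pullback q n F m G \<phi>) (pullback q m G l H \<psi>) u"
    using u_in by (simp add: compose_def u pullback_cls [OF \<psi> g h(2)] pullback_cls [OF \<phi> h(1) k(2)])
qed

text \<open>Two applications of contravariant functoriality differ from the claim by associativity
  of \<open>compose\<close>, which holds because the pullback along \<beta> lands in the coordinate
  module of H.\<close>

lemma pullback_natural:
  assumes \<alpha>: "\<alpha> \<in> carrier (Mor q n' F' n F)" and \<psi>: "\<psi> \<in> carrier (Mor q n F m (H :: 'a vec set))"
    and \<beta>: "\<beta> \<in> carrier (Mor q m H m' (H' :: 'a vec set))"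
  shows "pullback q n' F' m' H' (compose F' (compose F \<beta> \<psi>) \<alpha>) =
    compose (carrier (coord m' H'))
      (compose (carrier (coord m H)) (pullback q n' F' n F \<alpha>) (pullback q n F m H \<psi>))
      (pullback q m H m' H' \<beta>)"
  unfolding pullback_compose [OF \<alpha> Mor_compose [OF \<psi> \<beta>]] pullback_compose [OF \<psi> \<beta>]
  by (rule compose_assoc) (use Hom_apply [OF pullback_hom [OF \<beta>]] in auto)

end

text \<open>Naturality is measured against \<open>pullback\<close>, the action of morphisms on
  quotient modules. Taking \<psi> and \<beta> to be identities there, together with the clause on
  identities, forces \<Phi> to coincide with \<open>pullback\<close> on morphisms, which is why that
  is the witness.\<close>

theorem theorem2p14:
  fixes p q e :: nat
  assumes "prime p" and "CHAR('a::alg_closed_field) = p" and "q = p ^ e" and "e > 0"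
  shows
    "\<exists>\<Phi> :: nat \<Rightarrow> 'a vec set \<Rightarrow> nat \<Rightarrow> 'a vec set \<Rightarrow>
            ('a vec \<Rightarrow> 'a vec) \<Rightarrow> ('a mpoly set \<Rightarrow> 'a mpoly set).
      \<comment> \<open>isomorphisms of vector spaces\<close>
      (\<forall>n m F H. q_variety q n F \<and> q_variety q m H \<longrightarrow>
         linear_map (Fq q) (Mor q n F m H)
           (Hom_space q (coord_module q m H) (coord_module q n F)) (\<Phi> n F m H) \<and>
         bij_betw (\<Phi> n F m H) (carrier (Mor q n F m H))
           (carrier (Hom_space q (coord_module q m H) (coord_module q n F)))) \<and>
      \<comment> \<open>compatible with identities and composition\<close>
      (\<forall>n F. q_variety q n F \<longrightarrow>
         \<Phi> n F n F (\<lambda>x\<in>F. x) = (\<lambda>u\<in>carrier (coord_module q n F). u)) \<and>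
      (\<forall>n m l F G H \<phi> \<psi>.
         q_variety q n F \<and> q_variety q m G \<and> q_variety q l H \<and>
         \<phi> \<in> carrier (Mor q n F m G) \<and> \<psi> \<in> carrier (Mor q m G l H) \<longrightarrow>
         \<Phi> n F l H (compose F \<psi> \<phi>) =
           compose (carrier (coord_module q l H)) (\<Phi> n F m G \<phi>) (\<Phi> m G l H \<psi>)) \<and>
      \<comment> \<open>natural in both arguments\<close>
      (\<forall>n' n m m' F' F H H' \<alpha> \<psi> \<beta>.
         q_variety q n' F' \<and> q_variety q n F \<and> q_variety q m H \<and> q_variety q m' H' \<and>
         \<alpha> \<in> carrier (Mor q n' F' n F) \<and> \<psi> \<in> carrier (Mor q n F m H) \<and>
         \<beta> \<in> carrier (Mor q m H m' H') \<longrightarrow>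
         \<Phi> n' F' m' H' (compose F' (compose F \<beta> \<psi>) \<alpha>) =
           compose (carrier (coord_module q m' H'))
             (compose (carrier (coord_module q m H)) (pullback q n' F' n F \<alpha>) (\<Phi> n F m H \<psi>))
             (pullback q m H m' H' \<beta>))"
proof -
  interpret frobenius q e "TYPE('a)"
    by unfold_locales (use assms in simp_all)
  show ?thesis
    by (rule exI [of _ "pullback q"], intro conjI allI impI)
      (blast intro: pullback_linear pullback_bij | rule pullback_id |
        (rule pullback_compose pullback_natural; blast))+
qed

end
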